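(* Let $m,n\ge1$, $d=m+n$, $\Theta\in\mathbb{R}^{n\times m}$, weights $\sigma_1\ge\dots\ge\sigma_m>0$, $\rho_1\ge\dots\ge\rho_n>0$ with $\sum\sigma_j=\sum\rho_i=1$. For every $\delta\ge1$, \[ \underline{\psi}_1\big(\Lambda^\ast,\boldsymbol\mu^\ast(\delta)\big)\le1-\delta\implies\underline{\psi}_1\big(\Lambda,\boldsymbol\mu(\gamma_\delta)\big)\le1-\gamma_\delta, \] where $\gamma_\delta=\dfrac{(\sigma_m^{-1}-1)+\rho_n^{-1}\delta}{\sigma_m^{-1}+(\rho_n^{-1}-1)\delta}$.
   Context: $\Lambda=\Lambda(\Theta)=\begin{pmatrix}I_m&0\\-\Theta&I_n\end{pmatrix}\mathbb{Z}^d$ and $\Lambda^\ast=\begin{pmatrix}I_m&{}^t\Theta\\0&I_n\end{pmatrix}\mathbb{Z}^d$ (its dual lattice). $\mathcal T=\{\boldsymbol\tau\in\mathbb{R}^d:\sum\tau_i=0\}$; $\mathcal B$ the unit ball of the supremum norm; $\mathcal B_{\boldsymbol\tau}=\mathrm{diag}(e^{\tau_1},\dots,e^{\tau_d})\mathcal B$; $L_k(M,\boldsymbol\tau)=\log\lambda_k(\mathcal B_{\boldsymbol\tau},M)$, with $\lambda_k$ the $k$-th successive minimum. Set $\mathbf e_1=(1-d\sigma_1,\dots,1-d\sigma_m,1,\dots,1)$ (with $n$ ones), $\mathbf e_2=(1,\dots,1,1-d\rho_n,\dots,1-d\rho_1)$ (with $m$ ones), $\boldsymbol\mu(\gamma)=-\mathbf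 e_1+\gamma\mathbf e_2$, $\boldsymbol\mu^\ast(\delta)=\delta\mathbf e_1-\mathbf e_2$. For a lattice $M$ and $\boldsymbol\mu\in\mathcal T$, $\underline{\psi}_k(M,\boldsymbol\mu)=\liminf_{s\to+\infty}L_k(M,s\boldsymbol\mu)/s$. *)

theory Defs
  imports "Jordan_Normal_Form.VS_Connect" "HOL-Library.Extended_Real" "HOL-Library.Liminf_Limsup"
begin

text \<open>Vectors of \<open>\<real>\<^sup>d\<close> are elements of \<^term>\<open>carrier_vec d\<close>, with coordinates indexed from 0. The
  weights \<open>\<sigma>\<close>, \<open>\<rho>\<close> are functions on \<^typ>\<open>nat\<close> of which only the values at \<open>1, \<dots>, m\<close> and
  \<open>1, \<dots>, n\<close> are used.\<close>

definition int_vecs :: "nat \<Rightarrow> real vec set" where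
  "int_vecs d = {v \<in> carrier_vec d. \<forall>i<d. v $ i \<in> \<int>}"

definition lattice_of_mat :: "real mat \<Rightarrow> real vec set" where
  "lattice_of_mat A = (\<lambda>v. A *\<^sub>v v) ` int_vecs (dim_col A)"

definition Lambda :: "nat \<Rightarrow> nat \<Rightarrow> real mat \<Rightarrow> real vec set" where
  "Lambda m n \<Theta> = lattice_of_mat (four_block_mat (1\<^sub>m m) (0\<^sub>m m n) (- \<Theta>) (1\<^sub>m n))"

definition Lambda_dual :: "nat \<Rightarrow> nat \<Rightarrow> real mat \<Rightarrow> real vec set" where
  "Lambda_dual m n \<Theta> = lattice_of_mat (four_block_mat (1\<^sub>m m) (transpose_mat \<Theta>) (0\<^sub>m n m) (1\<^sub>m n))"

definition sup_ball :: "nat \<Rightarrow> real vec set" where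
  "sup_ball d = {x \<in> carrier_vec d. \<forall>i<d. \<bar>x $ i\<bar> \<le> 1}"

definition ball_tau :: "real vec \<Rightarrow> real vec set" where
  "ball_tau \<tau> = (\<lambda>x. mat_diag (dim_vec \<tau>) (\<lambda>i. exp (\<tau> $ i)) *\<^sub>v x) ` sup_ball (dim_vec \<tau>)"

text \<open>The \<open>k\<close>-th successive minimum of the body \<open>B\<close> with respect to the lattice \<open>M\<close> in
  \<open>\<real>\<^sup>d\<close>; linear independence is over the reals.\<close>

definition succ_min :: "nat \<Rightarrow> nat \<Rightarrow> real vec set \<Rightarrow> real vec set \<Rightarrow> real" where
  "succ_min d k B M = Inf {r. r > 0 \<and>
     (\<exists>S. S \<subseteq> M \<inter> (\<lambda>x. r \<cdot>\<^sub>v x) ` B \<and> finite S \<and> card S = k \<and>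
        \<not> module.lin_dep class_ring (module_vec TYPE(real) d) S)}"

definition L_fun :: "nat \<Rightarrow> real vec set \<Rightarrow> real vec \<Rightarrow> real" where
  "L_fun k M \<tau> = ln (succ_min (dim_vec \<tau>) k (ball_tau \<tau>) M)"

definition psi_lower :: "nat \<Rightarrow> real vec set \<Rightarrow> real vec \<Rightarrow> ereal" where
  "psi_lower k M \<mu> = Liminf at_top (\<lambda>s::real. ereal (L_fun k M (s \<cdot>\<^sub>v \<mu>) / s))"

definition trace_zero :: "nat \<Rightarrow> real vec set" where
  "trace_zero d = {\<tau> \<in> carrier_vec d. (\<Sum>i<d. \<tau> $ i) = 0}"

definition e1 :: "nat \<Rightarrow> nat \<Rightarrow> (nat \<Rightarrow> real) \<Rightarrow> real vec" where
  "e1 m n \<sigma> = vec (m + n) (\<lambda>i. if i < m then 1 - real (m + n) * \<sigma> (i + 1) else 1)"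

text \<open>The last \<open>n\<close> coordinates carry \<open>\<rho>\<close> in reversed order: position \<open>m\<close> (from 0) carries
  \<open>\<rho> n\<close>, position \<open>m + n - 1\<close> carries \<open>\<rho> 1\<close>.\<close>

definition e2 :: "nat \<Rightarrow> nat \<Rightarrow> (nat \<Rightarrow> real) \<Rightarrow> real vec" where
  "e2 m n \<rho> = vec (m + n) (\<lambda>i. if i < m then 1 else 1 - real (m + n) * \<rho> (m + n - i))"

definition mu :: "nat \<Rightarrow> nat \<Rightarrow> (nat \<Rightarrow> real) \<Rightarrow> (nat \<Rightarrow> real) \<Rightarrow> real \<Rightarrow> real vec" where
  "mu m n \<sigma> \<rho> \<gamma> = - e1 m n \<sigma> + \<gamma> \<cdot>\<^sub>v e2 m n \<rho>"

definition mu_dual :: "nat \<Rightarrow> nat \<Rightarrow> (nat \<Rightarrow> real) \<Rightarrow> (nat \<Rightarrow> real) \<Rightarrow> real \<Rightarrow> real vec" where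
  "mu_dual m n \<sigma> \<rho> \<delta> = \<delta> \<cdot>\<^sub>v e1 m n \<sigma> - e2 m n \<rho>"

lemma e1_trace_zero:
  assumes "(\<Sum>j=1..m. \<sigma> j) = 1"
  shows "e1 m n \<sigma> \<in> trace_zero (m + n)"
proof -
  have "(\<Sum>i<m + n. e1 m n \<sigma> $ i)
      = (\<Sum>i<m + n. if i < m then 1 - real (m + n) * \<sigma> (i + 1) else 1)"
    by (intro sum.cong) (auto simp: e1_def)
  also have "\<dots> = (\<Sum>i<m. 1 - real (m + n) * \<sigma> (i + 1)) + (\<Sum>i=m..<m + n. 1)"
    unfolding lessThan_atLeast0
    by (subst sum.atLeastLessThan_concat[of 0 m "m + n", symmetric]) auto
  also have "\<dots> = real (m + n) - real (m + n) * (\<Sum>i<m. \<sigma> (i + 1))"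
    by (simp add: sum_subtractf sum_distrib_left)
  also have "(\<Sum>i<m. \<sigma> (i + 1)) = (\<Sum>j=1..m. \<sigma> j)"
    by (rule sum.reindex_bij_witness[of _ "\<lambda>j. j - 1" "\<lambda>i. i + 1"]) auto
  finally show ?thesis
    using assms by (simp add: trace_zero_def e1_def)
qed

lemma e2_trace_zero:
  assumes "(\<Sum>i=1..n. \<rho> i) = 1"
  shows "e2 m n \<rho> \<in> trace_zero (m + n)"
proof -
  have "(\<Sum>i<m + n. e2 m n \<rho> $ i)
      = (\<Sum>i<m + n. if i < m then 1 else 1 - real (m + n) * \<rho> (m + n - i))"
    by (intro sum.cong) (auto simp: e2_def)
  also have "\<dots> = (\<Sum>i<m. 1) + (\<Sum>i=m..<m + n. 1 - real (m + n) * \<rho> (m + n - i))"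
    unfolding lessThan_atLeast0
    by (subst sum.atLeastLessThan_concat[of 0 m "m + n", symmetric]) auto
  also have "\<dots> = real (m + n) - real (m + n) * (\<Sum>i=m..<m + n. \<rho> (m + n - i))"
    by (simp add: sum_subtractf sum_distrib_left)
  also have "(\<Sum>i=m..<m + n. \<rho> (m + n - i)) = (\<Sum>i=1..n. \<rho> i)"
    by (rule sum.reindex_bij_witness[of _ "\<lambda>j. m + n - j" "\<lambda>i. m + n - i"]) auto
  finally show ?thesis
    using assms by (simp add: trace_zero_def e2_def)
qed

lemma mu_trace_zero:
  assumes "(\<Sum>j=1..m. \<sigma> j) = 1" "(\<Sum>i=1..n. \<rho> i) = 1"
  shows "mu m n \<sigma> \<rho> \<gamma> \<in> trace_zero (m + n)" "mu_dual m n \<sigma> \<rho> \<delta> \<in> trace_zero (m + n)"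
  using e1_trace_zero[OF assms(1), of n] e2_trace_zero[OF assms(2), of m]
  by (auto simp: trace_zero_def mu_def mu_dual_def sum.distrib sum_negf sum_subtractf
      simp flip: sum_distrib_left)

end

theory Submission
  imports Defs
begin

text \<open>
  Up to factors \<open>Y\<^sup>\<epsilon>\<close>, the hypothesis provides arbitrarily large \<open>Y\<close> and nonzero \<open>v \<in> \<Lambda>\<^sup>*\<close> with
  \<open>\<bar>v\<^sub>j\<bar> \<le> Y powr (- \<delta> \<sigma>\<^sub>j)\<close> in the first \<open>m\<close> coordinates and \<open>\<bar>v\<^sub>i\<bar> \<le> Y powr \<rho>\<^sub>i\<close> in the others, and
  the conclusion asks for arbitrarily large \<open>X\<close> and nonzero \<open>w \<in> \<Lambda>\<close> with \<open>\<bar>w\<^sub>j\<bar> \<le> X powr \<sigma>\<^sub>j\<close> and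
  \<open>\<bar>w\<^sub>i\<bar> \<le> X powr (- \<gamma> \<rho>\<^sub>i)\<close>.

  The bridge is Mahler's transference principle: if a nonzero \<open>v \<in> \<Lambda>\<^sup>*\<close> satisfies \<open>\<bar>v\<^sub>i\<bar> \<le> \<eta>\<^sub>i\<close> and
  \<open>H ^ (d - 1) = \<Prod>\<^sub>i \<eta>\<^sub>i\<close>, then some nonzero \<open>w \<in> \<Lambda>\<close> satisfies \<open>\<bar>w\<^sub>i\<bar> \<le> c\<^sub>d H / \<eta>\<^sub>i\<close>. To see this,
  choose \<open>k\<close> maximising \<open>\<bar>v\<^sub>k\<bar> / \<eta>\<^sub>k\<close>. The pairing of \<open>\<Lambda>\<close> with \<open>v\<close> is integer valued, so the pigeonhole
  principle in a large box with sides proportional to \<open>1 / \<eta>\<^sub>i\<close> gives \<open>w \<noteq> 0\<close> orthogonal to \<open>v\<close> with the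
  required bounds for \<open>i \<noteq> k\<close>; orthogonality and the choice of \<open>k\<close> then bound \<open>w\<^sub>k\<close>.

  It is applied with \<open>X = Y powr t\<close> and \<open>\<eta>\<^sub>j = X powr (1 - \<gamma> - \<sigma>\<^sub>j)\<close>, \<open>\<eta>\<^sub>i = X powr (1 - \<gamma> + \<gamma> \<rho>\<^sub>i)\<close>,
  for which \<open>H = X powr (1 - \<gamma>)\<close>. These dominate the bounds on \<open>v\<close> iff
  \<open>(\<delta> - t) \<sigma>\<^sub>j \<ge> t (\<gamma> - 1)\<close> and \<open>(t \<gamma> - 1) \<rho>\<^sub>i \<ge> t (\<gamma> - 1)\<close>; the value of \<open>\<gamma>\<close> comes from equality for
  the smallest weights \<open>\<sigma>\<^sub>m\<close> and \<open>\<rho>\<^sub>n\<close>.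
\<close>

section \<open>Block sums and matrix-vector products in coordinates\<close>

lemma sum_lessThan_add:
  fixes f :: "nat \<Rightarrow> 'a::comm_monoid_add"
  shows "(\<Sum>k<m + n. f k) = (\<Sum>k<m. f k) + (\<Sum>k<n. f (m + k))"
  by (induction n) (simp_all add: add.assoc)

lemma nat_less_addE:
  fixes k m n :: nat
  assumes "k < m + n" "\<not> k < m"
  obtains i where "k = m + i" "i < n"
  by (rule that[of "k - m"]) (use assms in auto)

lemma mult_mat_vec_index_sum:
  assumes "A \<in> carrier_mat r c" "z \<in> carrier_vec c" "i < r"
  shows "(A *\<^sub>v z) $ i = (\<Sum>k<c. A $$ (i, k) * z $ k)"
  using assms by (auto simp: scalar_prod_def lessThan_atLeast0 intro!: sum.cong)

lemma mat_diag_mult_vec_index: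
  assumes "z \<in> carrier_vec d" "i < d"
  shows "(mat_diag d f *\<^sub>v z) $ i = f i * z $ i"
proof -
  have "(mat_diag d f *\<^sub>v z) $ i = (\<Sum>k<d. mat_diag d f $$ (i, k) * z $ k)"
    using assms by (intro mult_mat_vec_index_sum) (simp_all add: mat_diag_def)
  also have "\<dots> = (\<Sum>k<d. if k = i then f i * z $ i else 0)"
    using assms by (intro sum.cong) (auto simp: mat_diag_def)
  finally show ?thesis using assms by simp
qed

section \<open>The first successive minimum and its lower exponent\<close>

lemma lin_dep_singleton_iff:
  fixes v :: "real vec"
  assumes "v \<in> carrier_vec d"
  shows "module.lin_dep class_ring (module_vec TYPE(real) d) {v} \<longleftrightarrow> v = 0\<^sub>v d"
proof -
  interpret vec_space "TYPE(real)" d .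
  have "lin_indpt {}" by (auto simp: lin_dep_def)
  from lin_dep_iff_in_span[OF _ this, of v] show ?thesis
    using assms span_empty by simp
qed

lemma mem_ball_tau_scaled_iff:
  assumes "dim_vec \<tau> = d" "r > 0"
  shows "v \<in> (\<lambda>x. r \<cdot>\<^sub>v x) ` ball_tau \<tau> \<longleftrightarrow>
    v \<in> carrier_vec d \<and> (\<forall>i<d. \<bar>v $ i\<bar> \<le> r * exp (\<tau> $ i))"
proof
  assume "v \<in> (\<lambda>x. r \<cdot>\<^sub>v x) ` ball_tau \<tau>"
  then obtain x where x: "x \<in> sup_ball d"
    and v: "v = r \<cdot>\<^sub>v (mat_diag d (\<lambda>i. exp (\<tau> $ i)) *\<^sub>v x)"
    using assms by (auto simp: ball_tau_def)
  have xd: "x \<in> carrier_vec d" using x by (simp add: sup_ball_def)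
  have "v $ i = r * exp (\<tau> $ i) * x $ i" if "i < d" for i
    using that xd mat_diag_mult_vec_index[of x d i "\<lambda>i. exp (\<tau> $ i)"]
      carrier_matD(1)[OF mat_diag_dim[of d "\<lambda>i. exp (\<tau> $ i)"]]
    by (simp add: v del: index_mult_mat_vec)
  moreover have "v \<in> carrier_vec d"
    unfolding v smult_carrier_vec by (rule mult_mat_vec_carrier[OF mat_diag_dim xd])
  ultimately show "v \<in> carrier_vec d \<and> (\<forall>i<d. \<bar>v $ i\<bar> \<le> r * exp (\<tau> $ i))"
    using x assms(2) by (auto simp: sup_ball_def abs_mult mult_left_le)
next
  assume v: "v \<in> carrier_vec d \<and> (\<forall>i<d. \<bar>v $ i\<bar> \<le> r * exp (\<tau> $ i))"
  define x where "x = vec d (\<lambda>i. v $ i / (r * exp (\<tau> $ i)))"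
  have "x \<in> sup_ball d"
    using v assms by (auto simp: sup_ball_def x_def abs_mult)
  moreover have "v = r \<cdot>\<^sub>v (mat_diag d (\<lambda>i. exp (\<tau> $ i)) *\<^sub>v x)"
  proof (rule eq_vecI)
    fix i assume "i < dim_vec (r \<cdot>\<^sub>v (mat_diag d (\<lambda>i. exp (\<tau> $ i)) *\<^sub>v x))"
    then have i: "i < d" by (simp add: mat_diag_def)
    have "x \<in> carrier_vec d" by (simp add: x_def)
    then show "v $ i = (r \<cdot>\<^sub>v (mat_diag d (\<lambda>i. exp (\<tau> $ i)) *\<^sub>v x)) $ i"
      using i assms mat_diag_mult_vec_index[of x d i "\<lambda>i. exp (\<tau> $ i)"]
        carrier_matD(1)[OF mat_diag_dim[of d "\<lambda>i. exp (\<tau> $ i)"]]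
      by (simp del: index_mult_mat_vec) (simp add: x_def)
  qed (use v in \<open>simp add: mat_diag_def\<close>)
  ultimately show "v \<in> (\<lambda>x. r \<cdot>\<^sub>v x) ` ball_tau \<tau>"
    using assms by (auto simp: ball_tau_def)
qed

text \<open>An independent set of size 1 is a single nonzero vector, so linear independence drops
  out of the first minimum.\<close>

lemma succ_min_1_eq:
  assumes "dim_vec \<tau> = d" "M \<subseteq> carrier_vec d"
  shows "succ_min d 1 (ball_tau \<tau>) M =
    Inf {r. r > 0 \<and> (\<exists>v\<in>M. v \<noteq> 0\<^sub>v d \<and> (\<forall>i<d. \<bar>v $ i\<bar> \<le> r * exp (\<tau> $ i)))}"
proof -
  have "(\<exists>S. S \<subseteq> M \<inter> (\<lambda>x. r \<cdot>\<^sub>v x) ` ball_tau \<tau> \<and> finite S \<and> card S = 1 \<and>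
          \<not> module.lin_dep class_ring (module_vec TYPE(real) d) S) \<longleftrightarrow>
        (\<exists>v\<in>M. v \<noteq> 0\<^sub>v d \<and> (\<forall>i<d. \<bar>v $ i\<bar> \<le> r * exp (\<tau> $ i)))" (is "?L \<longleftrightarrow> ?R")
    if "r > 0" for r
  proof
    assume ?L
    then obtain v where "v \<in> M" "v \<in> (\<lambda>x. r \<cdot>\<^sub>v x) ` ball_tau \<tau>"
      "\<not> module.lin_dep class_ring (module_vec TYPE(real) d) {v}"
      by (auto simp: card_1_singleton_iff)
    then show ?R
      using assms lin_dep_singleton_iff[of v d]
      by (auto simp: mem_ball_tau_scaled_iff[OF assms(1) that])
  next
    assume ?R
    then obtain v where v: "v \<in> M" "v \<noteq> 0\<^sub>v d" "\<forall>i<d. \<bar>v $ i\<bar> \<le> r * exp (\<tau> $ i)" by blast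
    then show ?L
      using assms lin_dep_singleton_iff[of v d]
      by (intro exI[of _ "{v}"]) (auto simp: mem_ball_tau_scaled_iff[OF assms(1) that])
  qed
  note eq = this
  show ?thesis
    unfolding succ_min_def by (intro arg_cong[of _ _ Inf] Collect_cong conj_cong refl eq)
qed

text \<open>A lower limit below \<open>y\<close> forces values below \<open>y\<close> at arbitrarily
  large \<open>s\<close>. The vector \<open>v0\<close> makes the set of admissible radii nonempty,
  so that its \<open>Inf\<close> is a genuine infimum.\<close>

lemma psi_lower_1_leD:
  assumes M: "M \<subseteq> carrier_vec d" and \<mu>: "dim_vec \<mu> = d"
    and v0: "v0 \<in> M" "v0 \<noteq> 0\<^sub>v d"
    and le: "psi_lower 1 M \<mu> \<le> ereal a" and "a < y"
  obtains s v where "s \<ge> s0" "s > 0" "v \<in> M" "v \<noteq> 0\<^sub>v d"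
    "\<And>i. i < d \<Longrightarrow> \<bar>v $ i\<bar> \<le> exp (s * (\<mu> $ i + y))"
proof -
  have "\<not> eventually (\<lambda>s. ereal y \<le> ereal (L_fun 1 M (s \<cdot>\<^sub>v \<mu>) / s)) at_top"
  proof
    assume "eventually (\<lambda>s. ereal y \<le> ereal (L_fun 1 M (s \<cdot>\<^sub>v \<mu>) / s)) at_top"
    then have "ereal y \<le> psi_lower 1 M \<mu>"
      unfolding psi_lower_def by (rule Liminf_bounded)
    with le \<open>a < y\<close> show False
      by (metis ereal_less_eq(3) leD order_trans)
  qed
  then obtain s where s: "s \<ge> max s0 1" and Ls: "L_fun 1 M (s \<cdot>\<^sub>v \<mu>) / s < y"
    unfolding eventually_at_top_linorder by (auto simp: not_le) (metis max.bounded_iff)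
  have "s > 0" using s by simp
  define A where "A = {r. r > 0 \<and>
    (\<exists>v\<in>M. v \<noteq> 0\<^sub>v d \<and> (\<forall>i<d. \<bar>v $ i\<bar> \<le> r * exp ((s \<cdot>\<^sub>v \<mu>) $ i)))}"
  have "L_fun 1 M (s \<cdot>\<^sub>v \<mu>) = ln (Inf A)"
    unfolding L_fun_def A_def index_smult_vec(2) \<mu> by (subst succ_min_1_eq[OF _ M]) (simp_all add: \<mu>)
  with Ls \<open>s > 0\<close> have L: "ln (Inf A) < s * y" by (simp add: pos_divide_less_eq mult.commute)
  \<comment> \<open>A radius at which \<open>v0\<close> itself is admissible; the summand 1 makes it
    positive.\<close>
  define r0 where "r0 = 1 + (\<Sum>i<d. \<bar>v0 $ i\<bar> / exp ((s \<cdot>\<^sub>v \<mu>) $ i))"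
  have "r0 > 0" unfolding r0_def by (intro add_pos_nonneg sum_nonneg) auto
  moreover have "\<bar>v0 $ i\<bar> \<le> r0 * exp ((s \<cdot>\<^sub>v \<mu>) $ i)" if "i < d" for i
  proof -
    have "\<bar>v0 $ i\<bar> / exp ((s \<cdot>\<^sub>v \<mu>) $ i) \<le> r0"
      using member_le_sum[of i "{..<d}" "\<lambda>i. \<bar>v0 $ i\<bar> / exp ((s \<cdot>\<^sub>v \<mu>) $ i)"] that
      by (simp add: r0_def)
    then show ?thesis by (simp add: divide_le_eq)
  qed
  ultimately have "r0 \<in> A" using v0 by (auto simp: A_def)
  then have ne: "A \<noteq> {}" by blast
  have "Inf A \<ge> 0"
    by (rule cInf_greatest[OF ne]) (auto simp: A_def)
  \<comment> \<open>If the infimum is 0 this is positivity of \<open>exp\<close>; otherwise the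
    logarithm is inverted.\<close>
  then have "Inf A < exp (s * y)"
    by (metis L exp_gt_zero exp_less_mono exp_ln order_le_less)
  from cInf_lessD[OF ne this] obtain r v where r: "0 < r" "r < exp (s * y)"
    and v: "v \<in> M" "v \<noteq> 0\<^sub>v d" "\<forall>i<d. \<bar>v $ i\<bar> \<le> r * exp ((s \<cdot>\<^sub>v \<mu>) $ i)"
    by (auto simp: A_def)
  have "\<bar>v $ i\<bar> \<le> exp (s * (\<mu> $ i + y))" if "i < d" for i
  proof -
    have "\<bar>v $ i\<bar> \<le> r * exp ((s \<cdot>\<^sub>v \<mu>) $ i)" using v that by blast
    also have "\<dots> \<le> exp (s * y) * exp ((s \<cdot>\<^sub>v \<mu>) $ i)" using r by simp
    also have "\<dots> = exp (s * (\<mu> $ i + y))"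
      using that \<mu> by (simp add: exp_add[symmetric] distrib_left add.commute)
    finally show ?thesis .
  qed
  with s \<open>s > 0\<close> v show thesis by (intro that[of s v]) auto
qed

text \<open>Discreteness keeps the first minimum positive, so the logarithm is monotone there and a
  vector in the body of radius \<open>exp (s * y)\<close> bounds \<open>L_fun\<close> by
  \<open>s * y\<close>.\<close>

lemma psi_lower_1_leI:
  assumes M: "M \<subseteq> carrier_vec d" and \<mu>: "dim_vec \<mu> = d"
    and discrete: "\<And>v. v \<in> M \<Longrightarrow> v \<noteq> 0\<^sub>v d \<Longrightarrow> \<exists>i<d. \<bar>v $ i\<bar> \<ge> 1"
    and ex: "\<And>y s0. y > a \<Longrightarrow> \<exists>s\<ge>s0. s > 0 \<and> (\<exists>v\<in>M. v \<noteq> 0\<^sub>v d \<and>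
      (\<forall>i<d. \<bar>v $ i\<bar> \<le> exp (s * (\<mu> $ i + y))))"
  shows "psi_lower 1 M \<mu> \<le> ereal a"
proof (rule ccontr)
  assume "\<not> psi_lower 1 M \<mu> \<le> ereal a"
  then have "ereal a < psi_lower 1 M \<mu>" by simp
  then obtain y where y: "a < y" "ereal y < psi_lower 1 M \<mu>"
    using ereal_dense2 by force
  from y(2) have "eventually (\<lambda>s. ereal y < ereal (L_fun 1 M (s \<cdot>\<^sub>v \<mu>) / s)) at_top"
    unfolding psi_lower_def by (rule less_LiminfD)
  then obtain s0 where s0: "\<And>s. s \<ge> s0 \<Longrightarrow> y < L_fun 1 M (s \<cdot>\<^sub>v \<mu>) / s"
    by (auto simp: eventually_at_top_linorder)
  from ex[OF y(1), of s0] obtain s v where s: "s \<ge> s0" "s > 0" and v: "v \<in> M" "v \<noteq> 0\<^sub>v d"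
    "\<forall>i<d. \<bar>v $ i\<bar> \<le> exp (s * (\<mu> $ i + y))" by blast
  define A where "A = {r. r > 0 \<and>
    (\<exists>v\<in>M. v \<noteq> 0\<^sub>v d \<and> (\<forall>i<d. \<bar>v $ i\<bar> \<le> r * exp ((s \<cdot>\<^sub>v \<mu>) $ i)))}"
  have "exp (s * (\<mu> $ i + y)) = exp (s * y) * exp ((s \<cdot>\<^sub>v \<mu>) $ i)" if "i < d" for i
    using that \<mu> by (simp add: exp_add[symmetric] distrib_left add.commute)
  then have mem: "exp (s * y) \<in> A" using v by (auto simp: A_def)
  \<comment> \<open>A positive lower bound for all admissible radii: a coordinate of modulus at
    least 1 forces \<open>r\<close> to be at least \<open>exp\<close> of minus the scaled
    exponent.\<close>
  define c where "c = exp (- (\<Sum>i<d. \<bar>(s \<cdot>\<^sub>v \<mu>) $ i\<bar>))"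
  have c: "c \<le> r" if "r \<in> A" for r
  proof -
    from that obtain u where "r > 0" and u: "u \<in> M" "u \<noteq> 0\<^sub>v d"
      "\<forall>i<d. \<bar>u $ i\<bar> \<le> r * exp ((s \<cdot>\<^sub>v \<mu>) $ i)" by (auto simp: A_def)
    from discrete[OF u(1,2)] obtain i where i: "i < d" "1 \<le> \<bar>u $ i\<bar>" by blast
    have "(s \<cdot>\<^sub>v \<mu>) $ i \<le> (\<Sum>i<d. \<bar>(s \<cdot>\<^sub>v \<mu>) $ i\<bar>)"
      using member_le_sum[of i "{..<d}" "\<lambda>i. \<bar>(s \<cdot>\<^sub>v \<mu>) $ i\<bar>"] i by simp
    then have "c \<le> exp (- ((s \<cdot>\<^sub>v \<mu>) $ i))" by (simp add: c_def)
    also have "1 \<le> r * exp ((s \<cdot>\<^sub>v \<mu>) $ i)" using u(3) i by force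
    then have "exp (- ((s \<cdot>\<^sub>v \<mu>) $ i)) \<le> r" by (simp add: exp_minus field_simps)
    finally show ?thesis .
  qed
  have "c \<le> Inf A" using mem c by (intro cInf_greatest) auto
  moreover have "c > 0" by (simp add: c_def)
  ultimately have pos: "Inf A > 0" by simp
  have "Inf A \<le> exp (s * y)" using mem c by (intro cInf_lower bdd_belowI)
  then have "ln (Inf A) \<le> s * y" using pos by (metis exp_gt_zero ln_exp ln_le_cancel_iff)
  moreover have "L_fun 1 M (s \<cdot>\<^sub>v \<mu>) = ln (Inf A)"
    unfolding L_fun_def A_def index_smult_vec(2) \<mu> by (subst succ_min_1_eq[OF _ M]) (simp_all add: \<mu>)
  ultimately have "L_fun 1 M (s \<cdot>\<^sub>v \<mu>) / s \<le> y"
    using \<open>s > 0\<close> by (simp add: pos_divide_le_eq mult.commute)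
  with s0[OF s(1)] show False by simp
qed

section \<open>The lattice and its dual in coordinates\<close>

text \<open>The defining matrix is unipotent, and changing the sign of \<open>\<Theta>\<close>
  inverts it; membership means that the preimage is integral.\<close>

lemma Lambda_iff:
  assumes \<Theta>: "\<Theta> \<in> carrier_mat n m"
  shows "w \<in> Lambda m n \<Theta> \<longleftrightarrow> w \<in> carrier_vec (m + n) \<and> (\<forall>j<m. w $ j \<in> \<int>) \<and>
    (\<forall>i<n. w $ (m + i) + (\<Sum>j<m. \<Theta> $$ (i, j) * w $ j) \<in> \<int>)" (is "_ \<longleftrightarrow> ?R w")
proof -
  define A where "A = four_block_mat (1\<^sub>m m) (0\<^sub>m m n) (- \<Theta>) (1\<^sub>m n)"
  have A: "A \<in> carrier_mat (m + n) (m + n)" using \<Theta> by (simp add: A_def)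
  have top: "(A *\<^sub>v z) $ j = z $ j" if "z \<in> carrier_vec (m + n)" "j < m" for z j
  proof -
    have "(A *\<^sub>v z) $ j = (\<Sum>k<m + n. A $$ (j, k) * z $ k)"
      using that by (intro mult_mat_vec_index_sum[OF A]) simp_all
    also have "\<dots> = (\<Sum>k<m. if k = j then z $ j else 0) + (\<Sum>k<n. 0)"
      unfolding sum_lessThan_add using that \<Theta>
      by (intro arg_cong2[of _ _ _ _ "(+)"] sum.cong) (auto simp: A_def)
    also have "\<dots> = z $ j"
      using that by (simp add: sum_negf)
    finally show ?thesis .
  qed
  have bot: "(A *\<^sub>v z) $ (m + i) = z $ (m + i) - (\<Sum>j<m. \<Theta> $$ (i, j) * z $ j)"
    if "z \<in> carrier_vec (m + n)" "i < n" for z i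
  proof -
    have "(A *\<^sub>v z) $ (m + i) = (\<Sum>k<m + n. A $$ (m + i, k) * z $ k)"
      using that by (intro mult_mat_vec_index_sum[OF A]) simp_all
    also have "\<dots> = (\<Sum>k<m. - (\<Theta> $$ (i, k) * z $ k)) + (\<Sum>k<n. if k = i then z $ (m + i) else 0)"
      unfolding sum_lessThan_add using that \<Theta>
      by (intro arg_cong2[of _ _ _ _ "(+)"] sum.cong) (auto simp: A_def)
    also have "\<dots> = z $ (m + i) - (\<Sum>j<m. \<Theta> $$ (i, j) * z $ j)"
      using that by (simp add: sum_negf)
    finally show ?thesis .
  qed
  have Lam: "Lambda m n \<Theta> = (\<lambda>v. A *\<^sub>v v) ` int_vecs (m + n)"
    using A by (simp add: Lambda_def lattice_of_mat_def A_def[symmetric])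
  show ?thesis
  proof
    assume "w \<in> Lambda m n \<Theta>"
    then show "?R w"
      using A by (auto simp: Lam int_vecs_def top bot)
  next
    assume w: "?R w"
    define z where "z = vec (m + n) (\<lambda>k. if k < m then w $ k
      else w $ k + (\<Sum>j<m. \<Theta> $$ (k - m, j) * w $ j))"
    have zc: "z \<in> carrier_vec (m + n)" by (simp add: z_def)
    have "z $ k \<in> \<int>" if k: "k < m + n" for k
    proof (cases "k < m")
      case False
      obtain i where "k = m + i" "i < n" by (rule nat_less_addE[OF k False])
      then show ?thesis using w by (simp add: z_def)
    qed (use w in \<open>simp add: z_def\<close>)
    then have "z \<in> int_vecs (m + n)" using zc by (simp add: int_vecs_def)
    moreover have "w = A *\<^sub>v z"
    proof (rule eq_vecI)
      fix k assume "k < dim_vec (A *\<^sub>v z)"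
      then have k: "k < m + n" using A by simp
      show "w $ k = (A *\<^sub>v z) $ k"
      proof (cases "k < m")
        case False
        obtain i where "k = m + i" "i < n" by (rule nat_less_addE[OF k False])
        then show ?thesis by (simp add: bot[OF zc]) (simp add: z_def)
      qed (simp add: top[OF zc], simp add: z_def)
    qed (use w A in simp)
    ultimately show "w \<in> Lambda m n \<Theta>" by (auto simp: Lam)
  qed
qed

lemma Lambda_dual_iff:
  assumes \<Theta>: "\<Theta> \<in> carrier_mat n m"
  shows "v \<in> Lambda_dual m n \<Theta> \<longleftrightarrow> v \<in> carrier_vec (m + n) \<and> (\<forall>i<n. v $ (m + i) \<in> \<int>) \<and>
    (\<forall>j<m. v $ j - (\<Sum>i<n. \<Theta> $$ (i, j) * v $ (m + i)) \<in> \<int>)" (is "_ \<longleftrightarrow> ?R v")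
proof -
  define A where "A = four_block_mat (1\<^sub>m m) (transpose_mat \<Theta>) (0\<^sub>m n m) (1\<^sub>m n)"
  have A: "A \<in> carrier_mat (m + n) (m + n)" using \<Theta> by (simp add: A_def)
  have bot: "(A *\<^sub>v z) $ (m + i) = z $ (m + i)" if "z \<in> carrier_vec (m + n)" "i < n" for z i
  proof -
    have "(A *\<^sub>v z) $ (m + i) = (\<Sum>k<m + n. A $$ (m + i, k) * z $ k)"
      using that by (intro mult_mat_vec_index_sum[OF A]) simp_all
    also have "\<dots> = (\<Sum>k<m. 0) + (\<Sum>k<n. if k = i then z $ (m + i) else 0)"
      unfolding sum_lessThan_add using that \<Theta>
      by (intro arg_cong2[of _ _ _ _ "(+)"] sum.cong) (auto simp: A_def)
    also have "\<dots> = z $ (m + i)"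
      using that by (simp add: sum_negf)
    finally show ?thesis .
  qed
  have top: "(A *\<^sub>v z) $ j = z $ j + (\<Sum>i<n. \<Theta> $$ (i, j) * z $ (m + i))"
    if "z \<in> carrier_vec (m + n)" "j < m" for z j
  proof -
    have "(A *\<^sub>v z) $ j = (\<Sum>k<m + n. A $$ (j, k) * z $ k)"
      using that by (intro mult_mat_vec_index_sum[OF A]) simp_all
    also have "\<dots> = (\<Sum>k<m. if k = j then z $ j else 0) + (\<Sum>k<n. \<Theta> $$ (k, j) * z $ (m + k))"
      unfolding sum_lessThan_add using that \<Theta>
      by (intro arg_cong2[of _ _ _ _ "(+)"] sum.cong) (auto simp: A_def)
    also have "\<dots> = z $ j + (\<Sum>i<n. \<Theta> $$ (i, j) * z $ (m + i))"
      using that by (simp add: sum_negf)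
    finally show ?thesis .
  qed
  have Lam: "Lambda_dual m n \<Theta> = (\<lambda>v. A *\<^sub>v v) ` int_vecs (m + n)"
    using A by (simp add: Lambda_dual_def lattice_of_mat_def A_def[symmetric])
  show ?thesis
  proof
    assume "v \<in> Lambda_dual m n \<Theta>"
    then show "?R v"
      using A by (auto simp: Lam int_vecs_def top bot)
  next
    assume v: "?R v"
    define z where "z = vec (m + n) (\<lambda>k. if k < m
      then v $ k - (\<Sum>i<n. \<Theta> $$ (i, k) * v $ (m + i)) else v $ k)"
    have zc: "z \<in> carrier_vec (m + n)" by (simp add: z_def)
    have "z $ k \<in> \<int>" if k: "k < m + n" for k
    proof (cases "k < m")
      case False
      obtain i where "k = m + i" "i < n" by (rule nat_less_addE[OF k False])
      then show ?thesis using v by (simp add: z_def)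
    qed (use v in \<open>simp add: z_def\<close>)
    then have "z \<in> int_vecs (m + n)" using zc by (simp add: int_vecs_def)
    moreover have "v = A *\<^sub>v z"
    proof (rule eq_vecI)
      fix k assume "k < dim_vec (A *\<^sub>v z)"
      then have k: "k < m + n" using A by simp
      show "v $ k = (A *\<^sub>v z) $ k"
      proof (cases "k < m")
        case False
        obtain i where "k = m + i" "i < n" by (rule nat_less_addE[OF k False])
        then show ?thesis by (simp add: bot[OF zc]) (simp add: z_def)
      qed (simp add: top[OF zc], simp add: z_def)
    qed (use v A in simp)
    ultimately show "v \<in> Lambda_dual m n \<Theta>" by (auto simp: Lam)
  qed
qed

text \<open>The two defining matrices are inverse transposes of each other: the mixed terms in
  \<open>\<Theta>\<close> cancel and only products of integers remain.\<close>

lemma Lambda_pairing_Ints: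
  assumes "\<Theta> \<in> carrier_mat n m" "w \<in> Lambda m n \<Theta>" "v \<in> Lambda_dual m n \<Theta>"
  shows "(\<Sum>k<m + n. w $ k * v $ k) \<in> \<int>"
proof -
  let ?y = "\<lambda>i. w $ (m + i) + (\<Sum>j<m. \<Theta> $$ (i, j) * w $ j)"
  let ?x = "\<lambda>j. v $ j - (\<Sum>i<n. \<Theta> $$ (i, j) * v $ (m + i))"
  have "(\<Sum>j<m. w $ j * (\<Sum>i<n. \<Theta> $$ (i, j) * v $ (m + i)))
      = (\<Sum>i<n. (\<Sum>j<m. \<Theta> $$ (i, j) * w $ j) * v $ (m + i))"
    by (simp only: sum_distrib_left sum_distrib_right) (subst sum.swap, simp add: ac_simps)
  then have "(\<Sum>k<m + n. w $ k * v $ k)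
      = (\<Sum>j<m. w $ j * ?x j) + (\<Sum>i<n. ?y i * v $ (m + i))"
    by (simp add: sum_lessThan_add right_diff_distrib distrib_right sum_subtractf sum.distrib)
  moreover have "\<dots> \<in> \<int>"
    using assms(2,3) unfolding Lambda_iff[OF assms(1)] Lambda_dual_iff[OF assms(1)]
    by (intro Ints_add[of "sum _ _" "sum _ _"] Ints_sum Ints_mult) auto
  ultimately show ?thesis by simp
qed

lemma Lambda_minus:
  assumes "\<Theta> \<in> carrier_mat n m" "v \<in> Lambda m n \<Theta>" "w \<in> Lambda m n \<Theta>"
  shows "v - w \<in> Lambda m n \<Theta>"
proof -
  have dims: "dim_vec v = m + n" "dim_vec w = m + n"
    using assms(2,3) by (auto simp: Lambda_iff[OF assms(1)])
  have "(v - w) $ (m + i) + (\<Sum>j<m. \<Theta> $$ (i, j) * (v - w) $ j)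
     = (v $ (m + i) + (\<Sum>j<m. \<Theta> $$ (i, j) * v $ j)) - (w $ (m + i) + (\<Sum>j<m. \<Theta> $$ (i, j) * w $ j))"
    if "i < n" for i
    using dims that by (simp add: right_diff_distrib sum_subtractf)
  moreover have "\<dots> i \<in> \<int>" if "i < n" for i
    using assms(2,3) that unfolding Lambda_iff[OF assms(1)] by (intro Ints_diff) auto
  ultimately show ?thesis
    using assms(2,3) dims unfolding Lambda_iff[OF assms(1)]
    by (auto simp del: index_minus_vec) (auto intro: Ints_diff)
qed

text \<open>The first \<open>m\<close> coordinates are integers, hence vanish if smaller than 1.
  Then the \<open>\<Theta>\<close> sums vanish too, the other coordinates become integers, and the
  same argument applies.\<close>

lemma Lambda_discrete:
  assumes \<Theta>: "\<Theta> \<in> carrier_mat n m" and w: "w \<in> Lambda m n \<Theta>" "w \<noteq> 0\<^sub>v (m + n)"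
  shows "\<exists>i<m + n. \<bar>w $ i\<bar> \<ge> 1"
proof (rule ccontr)
  assume "\<not> ?thesis"
  then have small: "\<bar>w $ i\<bar> < 1" if "i < m + n" for i using that by force
  have top: "w $ j = 0" if "j < m" for j
    using w that small[of j] \<Theta> by (auto simp: Lambda_iff intro: Ints_nonzero_abs_less1)
  have bot: "w $ (m + i) = 0" if "i < n" for i
    using w that small[of "m + i"] \<Theta> top by (auto simp: Lambda_iff intro!: Ints_nonzero_abs_less1)
  have "w $ k = 0" if "k < m + n" for k
    using top[of k] bot[of "k - m"] that by (cases "k < m") auto
  then have "w = 0\<^sub>v (m + n)" using w \<Theta> by (auto simp: Lambda_iff)
  with w show False by simp
qed

section \<open>Transference by counting lattice points\<close>

text \<open>The first \<open>m\<close> coordinates may be any integers; each of the others is then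
  fixed modulo 1, and \<open>frac\<close> selects its representative in the required unit interval.
  A box of unit cubes thus supplies one lattice point per cube.\<close>

lemma Lambda_unit_cubes:
  fixes g :: "nat \<Rightarrow> nat"
  assumes \<Theta>: "\<Theta> \<in> carrier_mat n m"
  obtains w where "w \<in> Lambda m n \<Theta>" "\<And>i. i < m + n \<Longrightarrow> \<lfloor>w $ i\<rfloor> = int (g i)"
proof -
  define w where "w = vec (m + n) (\<lambda>i. if i < m then real (g i)
    else real (g i) + frac (- (\<Sum>j<m. \<Theta> $$ (i - m, j) * real (g j))))"
  have "w \<in> Lambda m n \<Theta>"
    unfolding Lambda_iff[OF \<Theta>]
  proof (intro conjI allI impI)
    fix i assume "i < n"
    then have "w $ (m + i) + (\<Sum>j<m. \<Theta> $$ (i, j) * w $ j)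
        = real (g (m + i)) - of_int \<lfloor>- (\<Sum>j<m. \<Theta> $$ (i, j) * real (g j))\<rfloor>"
      by (simp add: w_def frac_def)
    then show "w $ (m + i) + (\<Sum>j<m. \<Theta> $$ (i, j) * w $ j) \<in> \<int>" by simp
  qed (auto simp: w_def)
  moreover have "\<lfloor>w $ i\<rfloor> = int (g i)" if "i < m + n" for i
    using that frac_ge_0 frac_lt_1 by (intro floor_unique) (auto simp: w_def)
  ultimately show thesis by (rule that)
qed

text \<open>The constant in the bound is far from optimal; only its independence of \<open>v\<close> and \<open>\<eta>\<close> matters,
  since it disappears in the lower limit.\<close>

lemma Lambda_transfer:
  fixes \<eta> :: "nat \<Rightarrow> real"
  assumes \<Theta>: "\<Theta> \<in> carrier_mat n m" and d: "d = m + n" "d \<ge> 2"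
    and v: "v \<in> Lambda_dual m n \<Theta>" "v \<noteq> 0\<^sub>v d"
    and \<eta>: "\<And>i. i < d \<Longrightarrow> \<eta> i > 0" and v_le: "\<And>i. i < d \<Longrightarrow> \<bar>v $ i\<bar> \<le> \<eta> i"
    and H: "H > 0" "H ^ (d - 1) = (\<Prod>i<d. \<eta> i)"
  obtains w where "w \<in> Lambda m n \<Theta>" "w \<noteq> 0\<^sub>v d"
    "\<And>i. i < d \<Longrightarrow> \<bar>w $ i\<bar> \<le> real d * (14 * real d + 1) * H / \<eta> i"
proof -
  have "finite {..<d}" "{..<d} \<noteq> {}" using d(2) by (auto simp: lessThan_empty_iff)
  then have "Max ((\<lambda>i. \<bar>v $ i\<bar> / \<eta> i) ` {..<d}) \<in> (\<lambda>i. \<bar>v $ i\<bar> / \<eta> i) ` {..<d}"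
    by (intro Max_in) auto
  then obtain k where k: "k < d"
    and Max_eq: "Max ((\<lambda>i. \<bar>v $ i\<bar> / \<eta> i) ` {..<d}) = \<bar>v $ k\<bar> / \<eta> k" by auto
  have kmax: "\<bar>v $ i\<bar> / \<eta> i \<le> \<bar>v $ k\<bar> / \<eta> k" if "i < d" for i
    unfolding Max_eq[symmetric] using that by (intro Max_ge) auto
  have vc: "v \<in> carrier_vec d" using v \<Theta> d by (auto simp: Lambda_dual_iff)
  have vk: "v $ k \<noteq> 0"
  proof
    assume "v $ k = 0"
    then have "v $ i = 0" if "i < d" for i
      using kmax[OF that] \<eta>[OF that] by (simp add: divide_le_0_iff)
    then have "v = 0\<^sub>v d" using vc by (intro eq_vecI) auto
    with v show False by simp
  qed
  \<comment> \<open>The pairing with \<open>v\<close> takes at most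
    \<open>2 * K + 1 \<le> 7 * R * real d\<close> values, and there are \<open>2 * Q\<close> cells
    along each axis other than \<open>k\<close>. This gives the factor 14; the summand 1 makes the
    final count strict.\<close>
  define C where "C = 14 * real d + 1"
  have C: "C > 0" by (simp add: C_def add_nonneg_pos)
  have sum_\<eta>: "\<eta> i \<le> (\<Sum>i<d. \<eta> i)" if "i < d" for i
    using that \<eta> by (intro member_le_sum) (auto simp: less_imp_le)
  \<comment> \<open>\<open>Q\<close> is a free scale. Taken large, it makes every
    \<open>R / \<eta> i\<close> at least 1, so that rounding up to \<open>N i\<close> at most
    doubles it.\<close>
  obtain Q :: nat where Q: "1 + (\<Sum>i<d. \<eta> i) < real Q * (C * H)"
    using reals_Archimedean3[of "C * H"] C H by auto
  define R where "R = C * H * real Q"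
  have R_ge: "\<eta> i \<le> R" if "i < d" for i
    using sum_\<eta>[OF that] Q by (simp add: R_def ac_simps)
  have "(\<Sum>i<d. \<eta> i) \<ge> 0" using \<eta> by (intro sum_nonneg) (auto simp: less_imp_le)
  then have R1: "R \<ge> 1" using Q by (simp add: R_def ac_simps)
  define N where "N i = nat \<lceil>R / \<eta> i\<rceil>" for i
  have N_ge: "R / \<eta> i \<le> real (N i)" for i
    unfolding N_def by linarith
  have N_le: "real (N i) \<le> 2 * R / \<eta> i" if "i < d" for i
  proof -
    have "1 \<le> R / \<eta> i" using R_ge[OF that] \<eta>[OF that] by simp
    then have "real (N i) \<le> R / \<eta> i + 1" unfolding N_def by linarith
    also have "\<dots> \<le> 2 * (R / \<eta> i)" using \<open>1 \<le> R / \<eta> i\<close> by simp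
    finally show ?thesis by simp
  qed
  define b where "b i = C * H / \<eta> i" for i
  have b: "b i > 0" if "i < d" for i using \<eta>[OF that] C H by (simp add: b_def)
  have Nb: "real (N i) / b i \<le> 2 * real Q" if "i < d" for i
  proof -
    have "real (N i) / b i \<le> (2 * R / \<eta> i) / b i"
      using N_le[OF that] b[OF that] by (intro divide_right_mono) auto
    also have "\<dots> = 2 * real Q" using \<eta>[OF that] C H by (simp add: R_def b_def)
    finally show ?thesis .
  qed
  have "\<forall>g. \<exists>w. w \<in> Lambda m n \<Theta> \<and> (\<forall>i<d. \<lfloor>w $ i\<rfloor> = int (g i))"
  proof
    fix g :: "nat \<Rightarrow> nat"
    show "\<exists>w. w \<in> Lambda m n \<Theta> \<and> (\<forall>i<d. \<lfloor>w $ i\<rfloor> = int (g i))"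
      using Lambda_unit_cubes[OF \<Theta>, of g] d(1) by blast
  qed
  from choice[OF this] obtain pt where pt: "\<And>g. pt g \<in> Lambda m n \<Theta>"
    and pt_floor: "\<And>g i. i < d \<Longrightarrow> \<lfloor>pt g $ i\<rfloor> = int (g i)" by blast
  define G where "G = (\<Pi>\<^sub>E i\<in>{..<d}. {..<N i})"
  have pt_bounds: "0 \<le> pt g $ i" "pt g $ i < real (N i)" if "g \<in> G" "i < d" for g i
  proof -
    have "g i < N i" using that by (auto simp: G_def)
    then show "0 \<le> pt g $ i" "pt g $ i < real (N i)"
      using pt_floor[OF that(2), of g] by linarith+
  qed
  define K where "K = \<lceil>2 * R * real d\<rceil>"
  \<comment> \<open>The pigeonholes: the pairing with \<open>v\<close>, and the cell of side
    \<open>b i\<close> in every coordinate except \<open>k\<close>. The pairing is an integer, so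
    taking its floor loses nothing.\<close>
  define F where "F g = (\<lfloor>\<Sum>i<d. pt g $ i * v $ i\<rfloor>,
    \<lambda>i\<in>{..<d} - {k}. \<lfloor>pt g $ i / b i\<rfloor>)" for g
  define T where "T = {- K..K} \<times> (\<Pi>\<^sub>E i\<in>{..<d} - {k}. {0..<2 * int Q})"
  have fin: "finite T" unfolding T_def by (intro finite_cartesian_product finite_PiE) auto
  have FT: "F ` G \<subseteq> T"
  proof
    fix z assume "z \<in> F ` G"
    then obtain g where g: "g \<in> G" "z = F g" by blast
    have "\<bar>\<Sum>i<d. pt g $ i * v $ i\<bar> \<le> (\<Sum>i<d. \<bar>pt g $ i * v $ i\<bar>)" by (rule sum_abs)
    also have "\<dots> \<le> (\<Sum>i<d. 2 * R)"
    proof (rule sum_mono)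
      fix i assume "i \<in> {..<d}"
      then have i: "i < d" by simp
      have "\<bar>pt g $ i * v $ i\<bar> \<le> (2 * R / \<eta> i) * \<eta> i"
        unfolding abs_mult using pt_bounds[OF g(1) i] N_le[OF i] v_le[OF i]
        by (intro mult_mono) auto
      also have "\<dots> = 2 * R" using \<eta>[OF i] by simp
      finally show "\<bar>pt g $ i * v $ i\<bar> \<le> 2 * R" .
    qed
    finally have "\<bar>\<Sum>i<d. pt g $ i * v $ i\<bar> \<le> 2 * R * real d" by (simp add: mult.commute)
    then have "\<lfloor>\<Sum>i<d. pt g $ i * v $ i\<rfloor> \<in> {- K..K}"
      unfolding K_def atLeastAtMost_iff by linarith
    moreover have "\<lfloor>pt g $ i / b i\<rfloor> \<in> {0..<2 * int Q}" if "i < d" for i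
    proof -
      have "pt g $ i / b i < real (N i) / b i"
        using pt_bounds[OF g(1) that] b[OF that] by (intro divide_strict_right_mono) auto
      then have "pt g $ i / b i < 2 * real Q" using Nb[OF that] by linarith
      moreover have "0 \<le> pt g $ i / b i"
        using pt_bounds(1)[OF g(1) that] b[OF that] by simp
      ultimately show ?thesis by (simp add: floor_less_iff)
    qed
    ultimately show "z \<in> T" by (auto simp: g(2) F_def T_def)
  qed
  have Rd: "1 \<le> R * real d" using mult_mono[of 1 R 1 "real d"] R1 d(2) by simp
  then have "K \<ge> 0" by (simp add: K_def)
  then have "real (card T) = (2 * real_of_int K + 1) * (2 * real Q) ^ (d - 1)"
    using k by (simp add: T_def card_cartesian_product card_PiE)
  also have "\<dots> \<le> 7 * R * real d * (2 * real Q) ^ (d - 1)"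
  proof (rule mult_right_mono)
    have "real_of_int K \<le> 2 * R * real d + 1" by (simp add: K_def)
    with Rd show "2 * real_of_int K + 1 \<le> 7 * R * real d" by simp
  qed simp
  also have "\<dots> < R * (C * real Q) ^ (d - 1)"
  proof -
    have "7 * real d * 2 ^ (d - 1) \<le> (7 * real d) ^ (d - 1) * 2 ^ (d - 1)"
      using d(2) self_le_power[of "7 * real d" "d - 1"] by (intro mult_right_mono) auto
    also have "\<dots> = (14 * real d) ^ (d - 1)" by (subst power_mult_distrib[symmetric]) (simp add: mult.commute mult.left_commute)
    also have "\<dots> < C ^ (d - 1)" using d(2) by (intro power_strict_mono) (auto simp: C_def)
    finally have "7 * real d * 2 ^ (d - 1) < C ^ (d - 1)" .
    moreover have "Q > 0" using R1 by (cases "Q = 0") (auto simp: R_def)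
    then have "R * real Q ^ (d - 1) > 0" using R1 by simp
    ultimately have "7 * real d * 2 ^ (d - 1) * (R * real Q ^ (d - 1)) < C ^ (d - 1) * (R * real Q ^ (d - 1))"
      by (rule mult_strict_right_mono)
    then show ?thesis by (simp add: power_mult_distrib ac_simps)
  qed
  \<comment> \<open>With \<open>H ^ (d - 1)\<close> equal to the product of the
    \<open>\<eta> i\<close>, this is the volume of the box with sides
    \<open>R / \<eta> i\<close>.\<close>
  also have "\<dots> = R ^ d / H ^ (d - 1)"
  proof -
    have "R ^ d = R * (C * real Q * H) ^ (d - 1)"
      using d(2) by (cases d) (simp_all add: R_def ac_simps)
    then show ?thesis using H(1) by (simp add: power_mult_distrib)
  qed
  also have "\<dots> = (\<Prod>i<d. R / \<eta> i)" unfolding H(2) by (simp add: prod_dividef)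
  also have "\<dots> \<le> (\<Prod>i<d. real (N i))"
    using N_ge \<eta> R1 by (intro prod_mono) (auto simp: less_imp_le)
  also have "\<dots> = real (card G)" by (simp add: G_def card_PiE)
  finally have "card T < card G" by simp
  then have "\<not> inj_on F G" using card_inj_on_le[OF _ FT fin] by linarith
  then obtain g h where gh: "g \<in> G" "h \<in> G" "g \<noteq> h" "F g = F h" by (auto simp: inj_on_def)
  define w where "w = pt g - pt h"
  have pc: "pt g \<in> carrier_vec d" for g using pt[of g] \<Theta> d by (auto simp: Lambda_iff)
  have w_nth: "w $ i = pt g $ i - pt h $ i" if "i < d" for i
    using that pc[of h] by (simp add: w_def)
  have wL: "w \<in> Lambda m n \<Theta>" unfolding w_def by (rule Lambda_minus[OF \<Theta> pt pt])
  have w0: "w \<noteq> 0\<^sub>v d"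
  proof
    assume "w = 0\<^sub>v d"
    then have "pt g $ i = pt h $ i" if "i < d" for i using w_nth[OF that] that by simp
    \<comment> \<open>The floors of a point recover its cube, so distinct indices give distinct
      lattice points.\<close>
    then have "g i = h i" if "i < d" for i
      using pt_floor[OF that, of g] pt_floor[OF that, of h] that by simp
    then have "g = h" using gh by (intro PiE_ext[of g "{..<d}" "\<lambda>i. {..<N i}"]) (auto simp: G_def)
    with gh show False by simp
  qed
  have w_small: "\<bar>w $ i\<bar> \<le> b i" if "i < d" "i \<noteq> k" for i
  proof -
    have "\<lfloor>pt g $ i / b i\<rfloor> = \<lfloor>pt h $ i / b i\<rfloor>"
      using gh(4) that by (auto simp: F_def restrict_def dest: fun_cong[of _ _ i])
    then have "\<bar>pt g $ i / b i - pt h $ i / b i\<bar> \<le> 1" by linarith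
    then show ?thesis
      using b[OF that(1)] by (simp add: w_nth[OF that(1)] diff_divide_distrib[symmetric])
  qed
  have "(\<Sum>i<d. pt g $ i * v $ i) = (\<Sum>i<d. pt h $ i * v $ i)"
  proof -
    have "(\<Sum>i<d. pt f $ i * v $ i) \<in> \<int>" for f
      using Lambda_pairing_Ints[OF \<Theta> pt v(1)] d(1) by simp
    then obtain x y where "(\<Sum>i<d. pt g $ i * v $ i) = of_int x" "(\<Sum>i<d. pt h $ i * v $ i) = of_int y"
      by (meson Ints_cases)
    with gh(4) show ?thesis by (simp add: F_def)
  qed
  then have "(\<Sum>i<d. w $ i * v $ i) = 0"
    by (simp add: w_nth left_diff_distrib sum_subtractf)
  \<comment> \<open>Orthogonality to \<open>v\<close> expresses the one uncontrolled coordinate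
    through the others; maximality at \<open>k\<close> turns each term into a multiple of
    \<open>\<bar>v $ k\<bar> / \<eta> k\<close>, and \<open>v $ k\<close> cancels.\<close>
  then have "w $ k * v $ k = - (\<Sum>i\<in>{..<d} - {k}. w $ i * v $ i)"
    using k by (simp add: sum.remove[of _ k])
  then have "\<bar>w $ k\<bar> * \<bar>v $ k\<bar> = \<bar>\<Sum>i\<in>{..<d} - {k}. w $ i * v $ i\<bar>"
    by (simp add: abs_mult[symmetric])
  also have "\<dots> \<le> (\<Sum>i\<in>{..<d} - {k}. \<bar>w $ i * v $ i\<bar>)" by (rule sum_abs)
  also have "\<dots> \<le> (\<Sum>i\<in>{..<d} - {k}. C * H * (\<bar>v $ k\<bar> / \<eta> k))"
  proof (rule sum_mono)
    fix i assume "i \<in> {..<d} - {k}"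
    then have i: "i < d" "i \<noteq> k" by auto
    have "\<bar>w $ i * v $ i\<bar> \<le> b i * \<bar>v $ i\<bar>"
      unfolding abs_mult by (intro mult_right_mono w_small i) simp
    also have "\<dots> = C * H * (\<bar>v $ i\<bar> / \<eta> i)" by (simp add: b_def)
    also have "\<dots> \<le> C * H * (\<bar>v $ k\<bar> / \<eta> k)"
      using C H by (intro mult_left_mono kmax i) simp
    finally show "\<bar>w $ i * v $ i\<bar> \<le> C * H * (\<bar>v $ k\<bar> / \<eta> k)" .
  qed
  also have "\<dots> = real (d - 1) * (C * H * (\<bar>v $ k\<bar> / \<eta> k))" using k by simp
  also have "\<dots> \<le> real d * (C * H * (\<bar>v $ k\<bar> / \<eta> k))"
    using C H \<eta>[OF k] by (intro mult_right_mono) auto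
  also have "\<dots> = (real d * C * H / \<eta> k) * \<bar>v $ k\<bar>" by simp
  finally have wk: "\<bar>w $ k\<bar> \<le> real d * C * H / \<eta> k"
    by (rule mult_right_le_imp_le) (use vk in simp)
  have "\<bar>w $ i\<bar> \<le> real d * C * H / \<eta> i" if i: "i < d" for i
  proof (cases "i = k")
    case False
    have "1 * b i \<le> real d * b i" using b[OF i] d(2) by (intro mult_right_mono) auto
    then show ?thesis using w_small[OF i False] by (simp add: b_def)
  qed (use wk in simp)
  with wL w0 show thesis by (intro that[of w]) (simp_all add: C_def)
qed

section \<open>Choice of the parameters and the exponent inequality\<close>

theorem theorem3:
  fixes m n :: nat and \<Theta> :: "real mat" and \<sigma> \<rho> :: "nat \<Rightarrow> real" and \<delta> \<gamma> :: real
  assumes "m \<ge> 1" and "n \<ge> 1"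
    and "\<Theta> \<in> carrier_mat n m"
    and "\<And>i j. 1 \<le> i \<Longrightarrow> i \<le> j \<Longrightarrow> j \<le> m \<Longrightarrow> \<sigma> j \<le> \<sigma> i" and "\<sigma> m > 0"
    and "\<And>i j. 1 \<le> i \<Longrightarrow> i \<le> j \<Longrightarrow> j \<le> n \<Longrightarrow> \<rho> j \<le> \<rho> i" and "\<rho> n > 0"
    and "(\<Sum>j=1..m. \<sigma> j) = 1" and "(\<Sum>i=1..n. \<rho> i) = 1"
    and "\<delta> \<ge> 1"
    and "\<gamma> = ((1 / \<sigma> m - 1) + (1 / \<rho> n) * \<delta>) / (1 / \<sigma> m + (1 / \<rho> n - 1) * \<delta>)"
    and "psi_lower 1 (Lambda_dual m n \<Theta>) (mu_dual m n \<sigma> \<rho> \<delta>) \<le> ereal (1 - \<delta>)"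
  shows "psi_lower 1 (Lambda m n \<Theta>) (mu m n \<sigma> \<rho> \<gamma>) \<le> ereal (1 - \<gamma>)"
proof -
  note \<Theta> = assms(3)
  define d where "d = m + n"
  have d2: "d \<ge> 2" using assms(1,2) by (simp add: d_def)
  define a where "a = \<sigma> m"
  define r where "r = \<rho> n"
  have a: "0 < a" and r: "0 < r" using assms(5,7) by (simp_all add: a_def r_def)
  \<comment> \<open>Nonnegative weights with sum 1 give \<open>r \<le> 1\<close>, which keeps the
    denominators in \<open>E\<close> and \<open>D\<close> positive.\<close>
  have "\<rho> i \<ge> 0" if "i \<in> {1..n}" for i
    using assms(6)[of i n] that assms(7) by auto
  then have r1: "r \<le> 1"
    using member_le_sum[of n "{1..n}" \<rho>] assms(2,9) by (simp add: r_def)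
  \<comment> \<open>Here \<open>t\<close> and \<open>\<gamma>\<close> solve \<open>(\<delta> - t) a = t (\<gamma> - 1) = (t \<gamma> - 1) r\<close>, with common value \<open>a r c\<close>.\<close>
  define c where "c = (\<delta> - 1) / (r + a * (1 - r))"
  define t where "t = \<delta> - r * c"
  have E: "r + a * (1 - r) > 0" using a r r1 by (simp add: add_pos_nonneg)
  have c: "c \<ge> 0" using E assms(10) by (simp add: c_def)
  have t_eq: "t = (r + \<delta> * a * (1 - r)) / (r + a * (1 - r))"
    using E by (simp add: t_def c_def field_simps)
  have D: "r + \<delta> * a * (1 - r) > 0" using a r r1 assms(10) by (simp add: add_pos_nonneg)
  have t: "t > 0" unfolding t_eq using D E by simp
  have "\<gamma> = (\<delta> * a + r - r * a) / (r + \<delta> * a * (1 - r))"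
  proof -
    have "1 / a - 1 + 1 / r * \<delta> = (\<delta> * a + r - r * a) / (a * r)"
      "1 / a + (1 / r - 1) * \<delta> = (r + \<delta> * a * (1 - r)) / (a * r)"
      using a r by (simp_all add: field_simps)
    then show ?thesis using assms(11) a r by (simp add: a_def r_def)
  qed
  then have "t * \<gamma> = (\<delta> * a + r - r * a) / (r + a * (1 - r))"
    using D by (simp add: t_eq)
  also have "\<dots> = 1 + a * c" using E by (simp add: c_def field_simps)
  finally have t\<gamma>: "t * \<gamma> = 1 + a * c" .
  have "r * c + a * c - c * (a * r) = c * (r + a * (1 - r))" by (simp add: algebra_simps)
  also have "\<dots> = \<delta> - 1" using E by (simp add: c_def)
  finally have slack: "t * (1 - \<gamma>) = - (a * r * c)"
    using t\<gamma> by (simp add: right_diff_distrib t_def algebra_simps)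

  have dims: "dim_vec (mu m n \<sigma> \<rho> \<gamma>) = d" "dim_vec (mu_dual m n \<sigma> \<rho> \<delta>) = d"
    by (simp_all add: mu_def mu_dual_def e1_def e2_def d_def)
  \<comment> \<open>\<open>p i\<close> is the target exponent of the coordinate \<open>i\<close> of
    \<open>w\<close>. Exponents are \<open>d\<close> times weights:
    \<open>X = exp (real d * S)\<close> and \<open>Y = exp (real d * s)\<close>, with
    \<open>S = t * s\<close>.\<close>
  define p where "p i = mu m n \<sigma> \<rho> \<gamma> $ i + (1 - \<gamma>)" for i
  have p: "p i = (if i < m then real d * \<sigma> (i + 1) else - (\<gamma> * real d * \<rho> (d - i)))" if "i < d" for i
    using that by (simp add: p_def mu_def e1_def e2_def d_def algebra_simps)
  have q: "mu_dual m n \<sigma> \<rho> \<delta> $ i + (1 - \<delta>)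
      = (if i < m then - (\<delta> * real d * \<sigma> (i + 1)) else real d * \<rho> (d - i))" if "i < d" for i
    using that by (simp add: mu_dual_def e1_def e2_def d_def algebra_simps)
  have sum_p: "(\<Sum>i<d. p i) = real d * (1 - \<gamma>)"
    using mu_trace_zero(1)[OF assms(8,9), of \<gamma>]
    by (simp add: p_def sum.distrib trace_zero_def d_def)
  \<comment> \<open>After \<open>slack\<close>, the two cases reduce to
    \<open>a \<le> \<sigma> (i + 1)\<close> and \<open>r \<le> \<rho> (d - i)\<close>, so the
    smallest weights are the critical ones.\<close>
  have exponents: "mu_dual m n \<sigma> \<rho> \<delta> $ i + (1 - \<delta>) \<le> t * (real d * (1 - \<gamma>) - p i)" if i: "i < d" for i
  proof (cases "i < m")
    case True
    have "a \<le> \<sigma> (i + 1)" using assms(4)[of "i + 1" m] True by (simp add: a_def)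
    then have "a * (r * c) \<le> \<sigma> (i + 1) * (r * c)" using r c by (intro mult_right_mono) auto
    then have "- (\<delta> * \<sigma> (i + 1)) \<le> t * (1 - \<gamma>) - t * \<sigma> (i + 1)"
      unfolding slack by (simp add: t_def algebra_simps)
    from mult_left_mono[OF this, of "real d"] show ?thesis
      using True unfolding q[OF i] p[OF i] by (simp add: algebra_simps)
  next
    case False
    then have "r \<le> \<rho> (d - i)" using assms(6)[of "d - i" n] i by (simp add: r_def d_def)
    then have "r * (a * c) \<le> \<rho> (d - i) * (a * c)" using a c by (intro mult_right_mono) auto
    then have "\<rho> (d - i) \<le> t * (1 - \<gamma>) + t * \<gamma> * \<rho> (d - i)"
      unfolding slack t\<gamma> by (simp add: algebra_simps)
    from mult_left_mono[OF this, of "real d"] show ?thesis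
      using False unfolding q[OF i] p[OF i] by (simp add: algebra_simps)
  qed

  show ?thesis
  proof (rule psi_lower_1_leI[OF _ dims(1)])
    show "Lambda m n \<Theta> \<subseteq> carrier_vec d" by (auto simp: Lambda_iff[OF \<Theta>] d_def)
    show "\<exists>i<d. 1 \<le> \<bar>w $ i\<bar>" if "w \<in> Lambda m n \<Theta>" "w \<noteq> 0\<^sub>v d" for w
      using Lambda_discrete[OF \<Theta> that[unfolded d_def]] by (simp add: d_def)
    fix y s0 :: real assume "1 - \<gamma> < y"
    define \<epsilon> where "\<epsilon> = y - (1 - \<gamma>)"
    have \<epsilon>: "\<epsilon> > 0" using \<open>1 - \<gamma> < y\<close> by (simp add: \<epsilon>_def)
    define K where "K = real d * (14 * real d + 1)"
    have K: "K > 0" using d2 by (simp add: K_def add_nonneg_pos)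
    \<comment> \<open>The nonzero dual vector that \<open>psi_lower_1_leD\<close> asks for; since
      \<open>m \<ge> 1\<close>, index 0 lies in the first block.\<close>
    have u: "unit_vec d 0 \<in> Lambda_dual m n \<Theta>" "unit_vec d 0 \<noteq> (0\<^sub>v d :: real vec)"
      using assms(1) d2 by (auto simp: Lambda_dual_iff[OF \<Theta>] d_def unit_vec_def vec_eq_iff)
    \<comment> \<open>Enlarging each \<open>\<eta> i\<close> by \<open>exp (s * \<epsilon>')\<close>
      enlarges \<open>H\<close> by \<open>exp (real d * (S * (\<epsilon> / 2)))\<close>, hence
      \<open>H / \<eta> i\<close> by only \<open>exp (S * (\<epsilon> / 2))\<close>. The other half
      of \<open>\<epsilon>\<close> absorbs \<open>K\<close>.\<close>
    define \<epsilon>' where "\<epsilon>' = real (d - 1) * (t * \<epsilon> / 2)"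
    have "\<epsilon>' > 0" using t \<epsilon> d2 by (simp add: \<epsilon>'_def)
    then have "1 - \<delta> < 1 - \<delta> + \<epsilon>'" by simp
    \<comment> \<open>The first lower bound on \<open>s\<close> yields \<open>S \<ge> s0\<close>,
      the second \<open>K \<le> exp (S * (\<epsilon> / 2))\<close>.\<close>
    then obtain s v where s: "s \<ge> max (s0 / t) (2 * ln K / (t * \<epsilon>))" "s > 0"
      and v: "v \<in> Lambda_dual m n \<Theta>" "v \<noteq> 0\<^sub>v d"
      and v_le: "\<And>i. i < d \<Longrightarrow> \<bar>v $ i\<bar> \<le> exp (s * (mu_dual m n \<sigma> \<rho> \<delta> $ i + (1 - \<delta> + \<epsilon>')))"
      using psi_lower_1_leD[OF _ dims(2) u assms(12)] Lambda_dual_iff[OF \<Theta>]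
      by (metis (no_types, lifting) d_def subsetI)
    define S where "S = t * s"
    have S: "S \<ge> s0" "S > 0" using s t by (simp_all add: S_def pos_divide_le_eq mult.commute)
    have "ln K \<le> S * (\<epsilon> / 2)" using s t \<epsilon> by (simp add: S_def pos_divide_le_eq mult.commute mult.left_commute)
    then have K_le: "K \<le> exp (S * (\<epsilon> / 2))" using K by (metis exp_le_cancel_iff exp_ln)
    define \<eta> where "\<eta> i = exp (S * (real d * (1 - \<gamma>) - p i) + s * \<epsilon>')" for i
    define H where "H = exp (S * (real d * (1 - \<gamma>)) + real d * (S * (\<epsilon> / 2)))"
    have s\<epsilon>': "s * \<epsilon>' = real (d - 1) * (S * (\<epsilon> / 2))" by (simp add: \<epsilon>'_def S_def)
    have "\<bar>v $ i\<bar> \<le> \<eta> i" if i: "i < d" for i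
    proof -
      have "s * (mu_dual m n \<sigma> \<rho> \<delta> $ i + (1 - \<delta>)) \<le> s * (t * (real d * (1 - \<gamma>) - p i))"
        using exponents[OF i] s by simp
      then have "s * (mu_dual m n \<sigma> \<rho> \<delta> $ i + (1 - \<delta> + \<epsilon>')) \<le> S * (real d * (1 - \<gamma>) - p i) + s * \<epsilon>'"
        by (simp add: S_def algebra_simps)
      then have "exp (s * (mu_dual m n \<sigma> \<rho> \<delta> $ i + (1 - \<delta> + \<epsilon>'))) \<le> \<eta> i"
        by (simp add: \<eta>_def)
      with v_le[OF i] show ?thesis by linarith
    qed
    moreover have "H ^ (d - 1) = (\<Prod>i<d. \<eta> i)"
    proof -
      \<comment> \<open>Since the \<open>p i\<close> sum to \<open>real d * (1 - \<gamma>)\<close>,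
        the exponent of the product is divisible by \<open>d - 1\<close>, and the quotient is the
        exponent of \<open>H\<close>.\<close>
      have rd: "real d = real (d - 1) + 1" using d2 by simp
      have "(\<Sum>i<d. S * (real d * (1 - \<gamma>) - p i) + s * \<epsilon>')
          = S * (real d * (real d * (1 - \<gamma>)) - (\<Sum>i<d. p i)) + real d * (s * \<epsilon>')"
        by (simp add: sum.distrib sum_distrib_left[symmetric] sum_subtractf)
      also have "\<dots> = real (d - 1) * (S * (real d * (1 - \<gamma>)) + real d * (S * (\<epsilon> / 2)))"
        unfolding sum_p s\<epsilon>' rd by (simp add: algebra_simps)
      finally show ?thesis
        by (simp add: H_def \<eta>_def exp_sum[symmetric] exp_of_nat_mult[symmetric])
    qed
    ultimately obtain w where w: "w \<in> Lambda m n \<Theta>" "w \<noteq> 0\<^sub>v d"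
      and w_le: "\<And>i. i < d \<Longrightarrow> \<bar>w $ i\<bar> \<le> K * H / \<eta> i"
      using Lambda_transfer[OF \<Theta> d_def d2 v, of \<eta> H] unfolding K_def H_def \<eta>_def by auto
    have "\<bar>w $ i\<bar> \<le> exp (S * (mu m n \<sigma> \<rho> \<gamma> $ i + y))" if i: "i < d" for i
    proof -
      have rd: "real d = real (d - 1) + 1" using d2 by simp
      have "H / \<eta> i = exp (S * p i + S * (\<epsilon> / 2))"
        unfolding H_def \<eta>_def exp_diff[symmetric] s\<epsilon>' by (subst (2) rd) (simp add: algebra_simps)
      then have "\<bar>w $ i\<bar> \<le> K * exp (S * p i + S * (\<epsilon> / 2))"
        using w_le[OF i] by (simp only: times_divide_eq_right[symmetric])
      also have "\<dots> \<le> exp (S * (\<epsilon> / 2)) * exp (S * p i + S * (\<epsilon> / 2))"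
        using K_le by simp
      also have "\<dots> = exp (S * (mu m n \<sigma> \<rho> \<gamma> $ i + y))"
        unfolding exp_add[symmetric] by (simp add: p_def \<epsilon>_def field_simps)
      finally show ?thesis .
    qed
    with S w show "\<exists>s\<ge>s0. s > 0 \<and> (\<exists>v\<in>Lambda m n \<Theta>. v \<noteq> 0\<^sub>v d \<and>
        (\<forall>i<d. \<bar>v $ i\<bar> \<le> exp (s * (mu m n \<sigma> \<rho> \<gamma> $ i + y))))"
      by blast
  qed
qed

end
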